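(* For every pair of integers $k \ge 3$ and $d \ge 2$ there is a constant $c = c(k,d)$ such that for every integer $m \ge 2$, $$r_d(k;m) \le 2^{cm}.$$
   Context: VC-dimension: for a set system $\mathcal{F}$ on a ground set $V$, the VC-dimension of $\mathcal{F}$ is the largest integer $d$ for which there is a $d$-element set $S \subset V$ such that for every subset $B \subset S$ there is $A \in \mathcal{F}$ with $A \cap S = B$. Dual VC-dimension: the dual of $\mathcal{F}$ is the set system $\mathcal{F}^{*}$ with ground set $\mathcal{F}$ given by $\mathcal{F}^{*} = \{\{A \in \mathcal{F} : v \in A\} : v \in V\}$. The dual VC-dimension of $\mathcal{F}$ is the VC-dimension of $\mathcal{F}^{*}$. Colorings: let $\chi$ be an $m$-coloring of the edges of the complete graph $K_n$ with colors $q_1,\dots,q_m$, and let $V$ be the vertex set of $K_n$. For $v \in V$ and $1\le i\le m$, let $N_{q_i}(v) = \{u \in V\setminus\{v\} : \chi(uv) = q_i\}$. The coloring $\chi$ has dual VC-dimension $d$ if the set system $\{N_{q_i}(v) : 1 \le i \le m,\ v \in V\}$ on the ground set $V$ has dual VC-dimension $d$. Ramsey number: for $k\ge 3$, $m \ge 2$, $d \ge 2$, $r_d(k;m)$ is the smallest integer $n$ such that every $m$-coloring of the edges of $K_n$ with dual VC-dimension at most $d$ contains a monochromatic clique on $k$ vertices. *)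

theory Defs
  imports Complex_Main "HOL-Library.Ramsey" "HOL-Library.Extended_Nat"
begin

definition shatters :: "'a set set \<Rightarrow> 'a set \<Rightarrow> bool" where
  "shatters F S \<longleftrightarrow> (\<forall>B. B \<subseteq> S \<longrightarrow> (\<exists>A\<in>F. A \<inter> S = B))"

text \<open>
  The supremum in \<^typ>\<open>enat\<close> is the largest size of a shattered set whenever such a
  largest size exists (lemma \<open>vc_dim_attained\<close>).  It is \<open>\<infinity>\<close> if there are
  arbitrarily large finite shattered sets, and \<open>0\<close> for the empty set system, which shatters
  nothing.
\<close>
definition vc_dim :: "'a set \<Rightarrow> 'a set set \<Rightarrow> enat" where
  "vc_dim V F = (SUP S\<in>{S. S \<subseteq> V \<and> finite S \<and> shatters F S}. enat (card S))"

definition dual_system :: "'a set \<Rightarrow> 'a set set \<Rightarrow> 'a set set set" where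
  "dual_system V F = (\<lambda>v. {A \<in> F. v \<in> A}) ` V"

text \<open>The ground set of the dual system is \<open>F\<close> itself.\<close>
definition dual_vc_dim :: "'a set \<Rightarrow> 'a set set \<Rightarrow> enat" where
  "dual_vc_dim V F = vc_dim F (dual_system V F)"

text \<open>
  \<open>K\<^sub>n\<close> has vertex set \<open>{..<n}\<close> and edge set \<open>[{..<n}]\<^bsup>2\<^esup>\<close>; an \<open>m\<close>-coloring maps edges
  to the colors \<open>{..<m}\<close>, not necessarily using all of them.
\<close>
definition edge_colorings :: "nat \<Rightarrow> nat \<Rightarrow> (nat set \<Rightarrow> nat) set" where
  "edge_colorings n m = [{..<n}]\<^bsup>2\<^esup> \<rightarrow> {..<m}"

definition color_nbhd :: "nat \<Rightarrow> (nat set \<Rightarrow> nat) \<Rightarrow> nat \<Rightarrow> nat \<Rightarrow> nat set" where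
  "color_nbhd n \<chi> q v = {u \<in> {..<n} - {v}. \<chi> {u, v} = q}"

definition nbhd_system :: "nat \<Rightarrow> nat \<Rightarrow> (nat set \<Rightarrow> nat) \<Rightarrow> nat set set" where
  "nbhd_system n m \<chi> = {color_nbhd n \<chi> q v | q v. q < m \<and> v < n}"

definition coloring_dual_vc_dim :: "nat \<Rightarrow> nat \<Rightarrow> (nat set \<Rightarrow> nat) \<Rightarrow> enat" where
  "coloring_dual_vc_dim n m \<chi> = dual_vc_dim {..<n} (nbhd_system n m \<chi>)"

definition forces_mono_clique :: "nat \<Rightarrow> nat \<Rightarrow> nat \<Rightarrow> nat \<Rightarrow> bool" where
  "forces_mono_clique d k m n \<longleftrightarrow>
     (\<forall>\<chi> \<in> edge_colorings n m. coloring_dual_vc_dim n m \<chi> \<le> enat d \<longrightarrow>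
        (\<exists>q<m. monochromatic {..<n} k 2 \<chi> q))"

text \<open>The minimum exists by Ramsey's theorem, see lemma \<open>ramsey_vc_works\<close>.\<close>
definition ramsey_vc :: "nat \<Rightarrow> nat \<Rightarrow> nat \<Rightarrow> nat" where
  "ramsey_vc d k m = (LEAST n. forces_mono_clique d k m n)"

lemma vc_dim_attained:
  assumes "S \<subseteq> V" "finite S" "shatters F S"
    and "\<And>T. T \<subseteq> V \<Longrightarrow> finite T \<Longrightarrow> shatters F T \<Longrightarrow> card T \<le> card S"
  shows "vc_dim V F = enat (card S)"
  unfolding vc_dim_def
  by (rule antisym) (use assms in \<open>auto intro!: SUP_least SUP_upper2[of S]\<close>)

lemma ramsey_vc_works:
  assumes "m \<ge> 1"
  shows "forces_mono_clique d k m (ramsey_vc d k m)"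
proof -
  obtain N :: nat where "partn_lst {..<N} (replicate m k) 2"
    using ramsey_full[of "replicate m k" 2] assms by auto
  then have "forces_mono_clique d k m N"
    unfolding forces_mono_clique_def edge_colorings_def partn_lst_def by fastforce
  then show ?thesis
    unfolding ramsey_vc_def by (rule LeastI)
qed

end

theory Submission
  imports Defs
begin

text \<open>
  Let \<open>X\<close> be a set of vertices and let \<open>\<omega> q\<close> be the size of the largest clique of colour \<open>q\<close>
  in \<open>X\<close>.  The proof shows \<open>card X \<le> A ^ (\<Sum>q. \<omega> q - 1)\<close>, where \<open>A\<close> depends only on the dual
  VC-dimension \<open>d\<close>.  If there is no monochromatic clique on \<open>k\<close> vertices, then the exponent is at
  most \<open>k * m\<close>, which gives the theorem.

  The bound is an induction on the exponent.  If \<open>X\<close> has at least two elements, then there are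
  \<open>h \<ge> 1\<close> and a subset \<open>W\<close> with \<open>card X \<le> A ^ h * card W\<close> such that passing from \<open>X\<close> to \<open>W\<close>
  lowers \<open>\<omega> q\<close> for at least \<open>h\<close> colours \<open>q\<close>.  For the latter it suffices that for each of these
  colours some vertex \<open>u\<close> of \<open>X\<close> is joined to all of \<open>W\<close> in colour \<open>q\<close>, because \<open>u\<close> extends
  every clique of colour \<open>q\<close> in \<open>W\<close>.

  To find \<open>W\<close>, let \<open>l\<close> be the least number for which one can give every vertex \<open>u\<close> a list \<open>L u\<close>
  of at most \<open>l\<close> colours such that the pairs \<open>(u, v)\<close> whose colour is not in \<open>L u\<close> form at most
  a \<open>1 / (2 * (l + 1))\<close> fraction of all pairs, and let \<open>h\<close> be the integer part of the binary
  logarithm of \<open>l + 1\<close>.  By minimality, lists of fewer than \<open>h\<close> colours miss a fraction of more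
  than \<open>1 / (2 * h)\<close>, which is at least twice as large.  Hence vertices can be added one by one to a
  set \<open>U\<close>, each showing a new listed colour to many vertices \<open>v\<close>, until after \<open>O(h\<^sup>2)\<close> steps at
  least a \<open>1 / (8 * h)\<close> fraction of the vertices are joined to \<open>U\<close> by at least \<open>h\<close> listed colours
  (lemma \<open>ex_lists_seeing_many_colours\<close>).  Only \<open>card U * l\<close> neighbourhoods \<open>N\<^sub>q(u)\<close> with
  \<open>u \<in> U\<close> and \<open>q \<in> L u\<close> are involved, so by the Sauer--Shelah lemma for the dual system the
  vertices have only polynomially many (in \<open>l\<close>, thus at most exponentially many in \<open>h\<close>) traces on
  them.  A most popular trace among the vertices that see \<open>h\<close> colours yields \<open>W\<close>.
\<close>

section \<open>The Sauer--Shelah lemma\<close>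

text \<open>Pajor's form of the lemma: a finite set system shatters at least as many sets as it has
  members.\<close>
lemma card_le_card_shattered:
  assumes "finite G" "T \<subseteq> Pow G"
  shows "card T \<le> card {S. S \<subseteq> G \<and> shatters T S}"
  using assms
proof (induction G arbitrary: T rule: finite_induct)
  case empty
  show ?case
  proof (cases "T = {}")
    case False
    then have T: "T = {{}}"
      using empty by auto
    then have "{S::'a set. S \<subseteq> {} \<and> shatters T S} = {{}}"
      by (auto simp: shatters_def)
    then show ?thesis
      using T by simp
  qed simp
next
  case (insert x G)
  define T0 where "T0 = {A \<in> T. x \<notin> A}"
  define T1 where "T1 = {A. x \<notin> A \<and> insert x A \<in> T}"
  \<comment> \<open>A set shattered by both \<open>T0\<close> and \<open>T1\<close> is counted twice on the right-hand side of the
    induction hypotheses; it contributes a second shattered set, its extension by \<open>x\<close>.\<close>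
  define Sh where "Sh = (\<lambda>T. {S. S \<subseteq> G \<and> shatters T S})"
  have finSh: "finite (Sh T')" for T'
    using insert.hyps(1) by (auto simp: Sh_def intro: finite_subset[of _ "Pow G"])
  have sub0: "T0 \<subseteq> Pow G" and sub1: "T1 \<subseteq> Pow G"
    using insert.prems by (auto simp: T0_def T1_def)
  have T_eq: "T = T0 \<union> insert x ` T1"
  proof (intro equalityI subsetI)
    fix A assume "A \<in> T"
    then show "A \<in> T0 \<union> insert x ` T1"
      by (cases "x \<in> A") (auto simp: T0_def T1_def image_iff insert_absorb
          intro!: bexI[of _ "A - {x}"] exI[of _ "A - {x}"])
  qed (auto simp: T0_def T1_def)
  have "card (insert x ` T1) = card T1"
    by (rule card_image) (auto simp: inj_on_def T1_def insert_ident)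
  then have "card T \<le> card T0 + card T1"
    using card_Un_le[of T0 "insert x ` T1"] T_eq by simp
  also have "\<dots> \<le> card (Sh T0) + card (Sh T1)"
    using insert.IH[OF sub0] insert.IH[OF sub1] by (simp add: Sh_def)
  also have "\<dots> = card (Sh T0 \<union> Sh T1) + card (Sh T0 \<inter> Sh T1)"
    by (rule card_Un_Int) (rule finSh)+
  also have "card (Sh T0 \<inter> Sh T1) = card (insert x ` (Sh T0 \<inter> Sh T1))"
    using insert.hyps(2)
    by (intro card_image[symmetric]) (auto simp: inj_on_def Sh_def insert_ident)
  also have "card (Sh T0 \<union> Sh T1) + card (insert x ` (Sh T0 \<inter> Sh T1))
      = card ((Sh T0 \<union> Sh T1) \<union> insert x ` (Sh T0 \<inter> Sh T1))"
    using insert.hyps(2) finSh by (intro card_Un_disjoint[symmetric]) (auto simp: Sh_def)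
  also have "\<dots> \<le> card {S. S \<subseteq> insert x G \<and> shatters T S}"
  proof (rule card_mono)
    show "finite {S. S \<subseteq> insert x G \<and> shatters T S}"
      using insert.hyps(1) by (auto intro: finite_subset[of _ "Pow (insert x G)"])
    have old: "shatters T S" if SG: "S \<subseteq> G" and sh: "shatters T0 S \<or> shatters T1 S" for S
      unfolding shatters_def
    proof (intro allI impI)
      fix B assume "B \<subseteq> S"
      then consider A where "A \<in> T0" "A \<inter> S = B" | A where "A \<in> T1" "A \<inter> S = B"
        using sh unfolding shatters_def by blast
      then show "\<exists>A\<in>T. A \<inter> S = B"
      proof cases
        case 1
        then show ?thesis by (auto simp: T0_def)
      next
        case 2
        moreover have "x \<notin> S"
          using SG insert.hyps(2) by auto
        ultimately show ?thesis
          by (auto simp: T1_def intro!: bexI[of _ "insert x A"])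
      qed
    qed
    have new: "shatters T (insert x S)"
      if SG: "S \<subseteq> G" and sh0: "shatters T0 S" and sh1: "shatters T1 S" for S
      unfolding shatters_def
    proof (intro allI impI)
      fix B assume B: "B \<subseteq> insert x S"
      have xS: "x \<notin> S"
        using SG insert.hyps(2) by auto
      have sub: "B - {x} \<subseteq> S"
        using B by auto
      show "\<exists>A\<in>T. A \<inter> insert x S = B"
      proof (cases "x \<in> B")
        case True
        obtain A where A: "A \<in> T1" "A \<inter> S = B - {x}"
          using sh1 sub unfolding shatters_def by blast
        show ?thesis
          by (rule bexI[of _ "insert x A"]) (use A True in \<open>auto simp: T1_def\<close>)
      next
        case False
        obtain A where A: "A \<in> T0" "A \<inter> S = B - {x}"
          using sh0 sub unfolding shatters_def by blast
        show ?thesis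
          by (rule bexI[of _ A]) (use A False in \<open>auto simp: T0_def\<close>)
      qed
    qed
    show "(Sh T0 \<union> Sh T1) \<union> insert x ` (Sh T0 \<inter> Sh T1) \<subseteq> {S. S \<subseteq> insert x G \<and> shatters T S}"
      using old new by (auto simp: Sh_def)
  qed
  finally show ?case .
qed

lemma card_small_subsets_le:
  assumes "finite G"
  shows "finite {S. S \<subseteq> G \<and> card S \<le> d} \<and> card {S. S \<subseteq> G \<and> card S \<le> d} \<le> (card G + 1) ^ d"
proof (induction d)
  case 0
  have "{S. S \<subseteq> G \<and> card S \<le> 0} = {{}}"
    using assms by (auto dest: finite_subset)
  then show ?case
    by simp
next
  case (Suc d)
  define D where "D = {S. S \<subseteq> G \<and> card S \<le> d}"
  define f where "f = (\<lambda>(S, y :: 'a option). case y of None \<Rightarrow> S | Some x \<Rightarrow> insert x S)"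
  have "{S. S \<subseteq> G \<and> card S \<le> Suc d} \<subseteq> f ` (D \<times> insert None (Some ` G))"
  proof
    fix S assume S: "S \<in> {S. S \<subseteq> G \<and> card S \<le> Suc d}"
    show "S \<in> f ` (D \<times> insert None (Some ` G))"
    proof (cases "card S \<le> d")
      case True
      then have "S = f (S, None)" "S \<in> D"
        using S by (auto simp: f_def D_def)
      then show ?thesis by blast
    next
      case False
      then obtain x where x: "x \<in> S"
        by fastforce
      then have "S = f (S - {x}, Some x)" "S - {x} \<in> D" "x \<in> G"
        using S assms by (auto simp: f_def D_def finite_subset)
      then show ?thesis by blast
    qed
  qed
  moreover have fin: "finite (D \<times> insert None (Some ` G))"
    using Suc assms by (auto simp: D_def)
  ultimately have "card {S. S \<subseteq> G \<and> card S \<le> Suc d} \<le> card (D \<times> insert None (Some ` G))"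
    by (rule surj_card_le[rotated])
  also have "\<dots> = card D * (card G + 1)"
    using assms by (simp add: card_cartesian_product card_image)
  also have "\<dots> \<le> (card G + 1) ^ Suc d"
    using mult_le_mono1[of "card D" "(card G + 1) ^ d" "card G + 1"] Suc
    by (simp add: D_def mult.commute)
  finally show ?case
    using assms by (auto intro: finite_subset[of _ "Pow G"])
qed

theorem sauer_shelah:
  assumes "finite G" "T \<subseteq> Pow G"
    and "\<And>S. S \<subseteq> G \<Longrightarrow> shatters T S \<Longrightarrow> card S \<le> d"
  shows "card T \<le> (card G + 1) ^ d"
proof -
  have "card T \<le> card {S. S \<subseteq> G \<and> shatters T S}"
    using assms(1,2) by (rule card_le_card_shattered)
  also have "\<dots> \<le> card {S. S \<subseteq> G \<and> card S \<le> d}"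
    using card_small_subsets_le[OF assms(1)] assms(3) by (intro card_mono) auto
  finally show ?thesis
    using card_small_subsets_le[OF assms(1), of d] by linarith
qed

section \<open>Vertices that see many listed colours\<close>

text \<open>The ordered pairs of distinct vertices whose colour is not listed at their first vertex.\<close>
definition unlisted_pairs :: "'a set \<Rightarrow> ('a \<Rightarrow> 'a \<Rightarrow> 'c) \<Rightarrow> ('a \<Rightarrow> 'c set) \<Rightarrow> ('a \<times> 'a) set" where
  "unlisted_pairs X f L = {(u, v). u \<in> X \<and> v \<in> X \<and> u \<noteq> v \<and> f u v \<notin> L u}"

text \<open>The colours that join \<open>v\<close> to a vertex of \<open>U\<close> at which they are listed.\<close>
definition seen_colours :: "('a \<Rightarrow> 'a \<Rightarrow> 'c) \<Rightarrow> ('a \<Rightarrow> 'c set) \<Rightarrow> 'a set \<Rightarrow> 'a \<Rightarrow> 'c set" where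
  "seen_colours f L U v = {f u v | u. u \<in> U \<and> u \<noteq> v \<and> f u v \<in> L u}"

lemma finite_unlisted_pairs: "finite X \<Longrightarrow> finite (unlisted_pairs X f L)"
  by (rule finite_subset[of _ "X \<times> X"]) (auto simp: unlisted_pairs_def)

lemma finite_seen_colours: "finite U \<Longrightarrow> finite (seen_colours f L U v)"
  by (rule finite_subset[of _ "(\<lambda>u. f u v) ` U"]) (auto simp: seen_colours_def)

lemma card_off_diagonal:
  assumes "finite X" "Y \<subseteq> X"
  shows "card (SIGMA v:Y. X - {v}) = card Y * (card X - 1)"
proof -
  have "finite Y"
    using assms finite_subset by blast
  then have "card (SIGMA v:Y. X - {v}) = (\<Sum>v\<in>Y. card (X - {v}))"
    using assms by (intro card_SigmaI) auto
  also have "\<dots> = (\<Sum>v\<in>Y. card X - 1)"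
    using assms by (intro sum.cong) auto
  finally show ?thesis by simp
qed

text \<open>
  The greedy step.  Few pairs are unlisted for \<open>L\<close>, but more are unlisted for any system of
  lists of fewer than \<open>h\<close> colours, in particular for the sets of colours seen by the vertices
  that see fewer than \<open>h\<close> colours.  If almost all vertices are of this kind, then some vertex \<open>u\<close>
  shows a new listed colour to many of them.
\<close>
lemma ex_vertex_showing_new_colours:
  assumes fin: "finite X" and fU: "U \<subseteq> X" and h: "h \<ge> 1"
    and sym: "\<And>u v. f u v = f v u"
    and K: "\<And>u. u \<in> X \<Longrightarrow> L u \<subseteq> K"
    and L: "4 * h * card (unlisted_pairs X f L) \<le> card X * (card X - 1)"
    and min: "\<And>C. (\<And>v. v \<in> X \<Longrightarrow> C v \<subseteq> K \<and> card (C v) < h) \<Longrightarrow>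
        2 * h * card (unlisted_pairs X f C) > card X * (card X - 1)"
    and few: "8 * h * card {v \<in> X. card (seen_colours f L U v) \<ge> h} < card X"
  obtains u where "u \<in> X"
    "card X - 1 \<le> 8 * h * card {v \<in> X. card (seen_colours f L U v) < h \<and> u \<noteq> v
        \<and> f u v \<in> L u \<and> f u v \<notin> seen_colours f L U v}"
proof -
  define Y where "Y = {v \<in> X. card (seen_colours f L U v) \<ge> h}"
  define E where "E = (\<lambda>u. {v \<in> X. card (seen_colours f L U v) < h \<and> u \<noteq> v
        \<and> f u v \<in> L u \<and> f u v \<notin> seen_colours f L U v})"
  \<comment> \<open>Vertices that already see \<open>h\<close> colours get the empty list; there are too few of them to matter.\<close>
  define C where "C = (\<lambda>v. if v \<in> Y then {} else seen_colours f L U v)"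
  define P where "P = card X * (card X - 1)"
  have "C v \<subseteq> K \<and> card (C v) < h" if "v \<in> X" for v
    using that h fU K by (auto simp: C_def Y_def seen_colours_def subset_iff)
  then have D: "2 * h * card (unlisted_pairs X f C) > P"
    unfolding P_def by (rule min)
  have finE: "finite (SIGMA u:X. E u)"
    using fin by (auto simp: E_def)
  have "unlisted_pairs X f C \<subseteq> prod.swap ` (SIGMA u:X. E u) \<union> (SIGMA v:Y. X - {v})
      \<union> prod.swap ` unlisted_pairs X f L"
  proof
    fix p assume "p \<in> unlisted_pairs X f C"
    then obtain v u where p: "p = (v, u)" "v \<in> X" "u \<in> X" "v \<noteq> u" "f v u \<notin> C v"
      by (auto simp: unlisted_pairs_def)
    consider "v \<in> Y" | "v \<notin> Y" "f u v \<notin> L u" | "v \<notin> Y" "f u v \<in> L u"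
      by blast
    then show "p \<in> prod.swap ` (SIGMA u:X. E u) \<union> (SIGMA v:Y. X - {v})
      \<union> prod.swap ` unlisted_pairs X f L"
    proof cases
      case 1
      then show ?thesis using p by auto
    next
      case 2
      then have "(u, v) \<in> unlisted_pairs X f L"
        using p by (auto simp: unlisted_pairs_def)
      then show ?thesis using p(1) by force
    next
      case 3
      then have "(u, v) \<in> (SIGMA u:X. E u)"
        using p sym[of u v] by (auto simp: E_def C_def Y_def)
      then show ?thesis using p(1) by force
    qed
  qed
  then have "card (unlisted_pairs X f C) \<le> card (prod.swap ` (SIGMA u:X. E u)
      \<union> (SIGMA v:Y. X - {v}) \<union> prod.swap ` unlisted_pairs X f L)"
    using fin finE finite_unlisted_pairs[OF fin] by (intro card_mono) (auto simp: Y_def)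
  also have "\<dots> \<le> card (prod.swap ` (SIGMA u:X. E u)) + card (SIGMA v:Y. X - {v})
      + card (prod.swap ` unlisted_pairs X f L)"
    by (meson card_Un_le add_le_mono1 le_trans)
  also have "\<dots> \<le> card (SIGMA u:X. E u) + card Y * (card X - 1) + card (unlisted_pairs X f L)"
    using card_image_le[OF finE, of prod.swap] fin
      card_image_le[OF finite_unlisted_pairs[OF fin, of f L], of prod.swap]
      card_off_diagonal[OF fin, of Y] by (auto simp: Y_def)
  finally have "8 * h * card (unlisted_pairs X f C) \<le> 8 * h * (card (SIGMA u:X. E u)
      + card Y * (card X - 1) + card (unlisted_pairs X f L))"
    by (rule mult_le_mono2)
  moreover have "8 * h * card Y * (card X - 1) \<le> P"
    unfolding P_def using few by (intro mult_le_mono1) (simp add: Y_def)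
  ultimately have "P < 8 * h * card (SIGMA u:X. E u)"
    using D L unfolding P_def[symmetric] by (simp add: algebra_simps)
  also have "card (SIGMA u:X. E u) = (\<Sum>u\<in>X. card (E u))"
    using fin by (intro card_SigmaI) (auto simp: E_def)
  finally have sum: "P < (\<Sum>u\<in>X. 8 * h * card (E u))"
    by (simp add: sum_distrib_left)
  have "\<exists>u\<in>X. card X - 1 \<le> 8 * h * card (E u)"
  proof (rule ccontr)
    assume "\<not> ?thesis"
    then have "(\<Sum>u\<in>X. 8 * h * card (E u)) \<le> (\<Sum>u\<in>X. card X - 1)"
      by (intro sum_mono) auto
    then show False
      using sum by (simp add: P_def)
  qed
  then show thesis
    using that by (auto simp: E_def)
qed

lemma ex_power_of_two_interval:
  assumes "l \<ge> (1::nat)"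
  obtains h where "h \<ge> 1" "2 ^ h \<le> l + 1" "l + 1 < 2 ^ (h + 1)"
proof -
  obtain h :: nat where h: "2 ^ h \<le> l + 1" "l + 1 < 2 ^ (h + 1)"
    using ex_power_ivl1[of 2 "l + 1"] by auto
  have "h \<noteq> 0"
    using h assms by (intro notI) simp
  then show thesis
    using that[of h] h by simp
qed

lemma ex_lists_seeing_many_colours:
  assumes fin: "finite X" and X: "card X \<ge> 2" and finK: "finite K"
    and sym: "\<And>u v. f u v = f v u"
    and col: "\<And>u v. u \<in> X \<Longrightarrow> v \<in> X \<Longrightarrow> u \<noteq> v \<Longrightarrow> f u v \<in> K"
  obtains h l :: nat and L U where "h \<ge> 1" "l + 1 < 2 ^ (h + 1)"
    "\<And>u. u \<in> X \<Longrightarrow> L u \<subseteq> K \<and> card (L u) \<le> l"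
    "U \<subseteq> X" "card U \<le> 17 * h\<^sup>2"
    "card X \<le> 8 * h * card {v \<in> X. card (seen_colours f L U v) \<ge> h}"
proof -
  define P where "P = card X * (card X - 1)"
  define good where "good = (\<lambda>l. \<exists>L. (\<forall>u\<in>X. L u \<subseteq> K \<and> card (L u) \<le> l)
      \<and> 2 * (l + 1) * card (unlisted_pairs X f L) \<le> P)"
  have "unlisted_pairs X f (\<lambda>u. K) = {}"
    using col by (auto simp: unlisted_pairs_def)
  then have "good (card K)"
    unfolding good_def by (intro exI[of _ "\<lambda>u. K"]) simp
  define l where "l = (LEAST l. good l)"
  have "good l"
    unfolding l_def by (rule LeastI) fact
  then obtain L where L: "\<And>u. u \<in> X \<Longrightarrow> L u \<subseteq> K \<and> card (L u) \<le> l"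
    and bad: "2 * (l + 1) * card (unlisted_pairs X f L) \<le> P"
    unfolding good_def by blast
  have not_good: "\<not> good j" if "j < l" for j
    using that not_less_Least unfolding l_def by blast
  have "P > 0"
    using X by (simp add: P_def)
  have "\<not> good 0"
  proof
    assume "good 0"
    then obtain M where M: "\<forall>u\<in>X. M u \<subseteq> K \<and> card (M u) \<le> 0"
      and MP: "2 * (0 + 1) * card (unlisted_pairs X f M) \<le> P"
      unfolding good_def by blast
    have "M u = {}" if "u \<in> X" for u
      using M that finK by (metis card_eq_0_iff finite_subset le_zero_eq)
    then have "unlisted_pairs X f M = (SIGMA v:X. X - {v})"
      by (auto simp: unlisted_pairs_def)
    then have "card (unlisted_pairs X f M) = P"
      using card_off_diagonal[OF fin, of X] by (simp add: P_def)
    then show False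
      using MP \<open>P > 0\<close> by simp
  qed
  then have "l \<ge> 1"
    using \<open>good l\<close> by (cases l) auto
  then obtain h where h: "h \<ge> 1" "2 ^ h \<le> l + 1" "l + 1 < 2 ^ (h + 1)"
    by (rule ex_power_of_two_interval)
  have pow: "2 * h \<le> 2 ^ h"
    using h(1) by (induction h rule: dec_induct) auto
  then have hl: "2 * h \<le> l + 1"
    using h(2) by linarith
  have min: "2 * h * card (unlisted_pairs X f C) > P"
    if "\<And>v. v \<in> X \<Longrightarrow> C v \<subseteq> K \<and> card (C v) < h" for C
  proof (rule ccontr)
    assume "\<not> ?thesis"
    then have "good (h - 1)"
      unfolding good_def using that h(1) by (intro exI[of _ C]) fastforce
    moreover have "h - 1 < l"
      using hl h(1) by linarith
    ultimately show False
      using not_good by blast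
  qed
  have "4 * h * card (unlisted_pairs X f L) \<le> 2 * (l + 1) * card (unlisted_pairs X f L)"
    using hl by (intro mult_le_mono1) simp
  then have bad': "4 * h * card (unlisted_pairs X f L) \<le> P"
    using bad by linarith

  define Y where "Y = (\<lambda>U. {v \<in> X. card (seen_colours f L U v) \<ge> h})"
  \<comment> \<open>Each greedy step raises \<open>\<Psi>\<close> by at least \<open>(card X - 1) / (8 * h)\<close>.\<close>
  define \<Psi> where "\<Psi> = (\<lambda>U. \<Sum>v\<in>X. min (card (seen_colours f L U v)) h)"
  have greedy: "\<exists>U \<subseteq> X. card U \<le> t
      \<and> (card X \<le> 8 * h * card (Y U) \<or> t * (card X - 1) \<le> 8 * h * \<Psi> U)" for t
  proof (induction t)
    case 0
    show ?case by (intro exI[of _ "{}"]) simp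
  next
    case (Suc t)
    then obtain U where U: "U \<subseteq> X" "card U \<le> t"
      and cases: "card X \<le> 8 * h * card (Y U) \<or> t * (card X - 1) \<le> 8 * h * \<Psi> U"
      by blast
    show ?case
    proof (cases "card X \<le> 8 * h * card (Y U)")
      case True
      then show ?thesis
        using U by (intro exI[of _ U]) auto
    next
      case False
      then have few: "8 * h * card {v \<in> X. card (seen_colours f L U v) \<ge> h} < card X"
        by (simp add: Y_def)
      obtain u where u: "u \<in> X"
        "card X - 1 \<le> 8 * h * card {v \<in> X. card (seen_colours f L U v) < h \<and> u \<noteq> v
            \<and> f u v \<in> L u \<and> f u v \<notin> seen_colours f L U v}"
        by (rule ex_vertex_showing_new_colours[of X U h f L K])
          (use fin U h sym L bad' min few in \<open>auto simp: P_def\<close>)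
      define E where "E = {v \<in> X. card (seen_colours f L U v) < h \<and> u \<noteq> v
            \<and> f u v \<in> L u \<and> f u v \<notin> seen_colours f L U v}"
      have finU: "finite U"
        using U fin finite_subset by blast
      have step: "min (card (seen_colours f L U v)) h + (if v \<in> E then 1 else 0)
          \<le> min (card (seen_colours f L (insert u U) v)) h" for v
      proof (cases "v \<in> E")
        case True
        then have "insert (f u v) (seen_colours f L U v) \<subseteq> seen_colours f L (insert u U) v"
          by (auto simp: seen_colours_def E_def)
        then have "card (insert (f u v) (seen_colours f L U v))
            \<le> card (seen_colours f L (insert u U) v)"
          by (intro card_mono finite_seen_colours) (use finU in auto)
        then show ?thesis
          using True finite_seen_colours[OF finU, of f L v] by (auto simp: E_def)
      next
        case False
        have "card (seen_colours f L U v) \<le> card (seen_colours f L (insert u U) v)"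
          by (intro card_mono finite_seen_colours) (use finU in \<open>auto simp: seen_colours_def\<close>)
        then show ?thesis
          using False by auto
      qed
      have "\<Psi> U + card E = (\<Sum>v\<in>X. min (card (seen_colours f L U v)) h + (if v \<in> E then 1 else 0))"
        using fin by (simp add: \<Psi>_def sum.distrib sum.If_cases E_def Int_def conj_commute)
      also have "\<dots> \<le> \<Psi> (insert u U)"
        unfolding \<Psi>_def by (intro sum_mono step)
      finally have "8 * h * (\<Psi> U + card E) \<le> 8 * h * \<Psi> (insert u U)"
        by (rule mult_le_mono2)
      moreover have "t * (card X - 1) \<le> 8 * h * \<Psi> U"
        using cases False by blast
      moreover have "card X - 1 \<le> 8 * h * card E"
        using u(2) by (simp add: E_def)
      ultimately have "Suc t * (card X - 1) \<le> 8 * h * \<Psi> (insert u U)"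
        by (simp add: algebra_simps)
      moreover have "card (insert u U) \<le> Suc t"
        using card_insert_le_m1 U finU by (simp add: card_insert_if)
      ultimately show ?thesis
        using U u(1) by (intro exI[of _ "insert u U"]) auto
    qed
  qed
  \<comment> \<open>As \<open>\<Psi> U \<le> card X * h\<close>, the number \<open>t\<close> of steps is at most
    \<open>8 * h\<^sup>2 * card X / (card X - 1) \<le> 16 * h\<^sup>2\<close>.\<close>
  obtain U where U: "U \<subseteq> X" "card U \<le> 17 * h\<^sup>2"
    and cases: "card X \<le> 8 * h * card (Y U) \<or> 17 * h\<^sup>2 * (card X - 1) \<le> 8 * h * \<Psi> U"
    using greedy by blast
  have "\<not> 17 * h\<^sup>2 * (card X - 1) \<le> 8 * h * \<Psi> U"
  proof
    assume "17 * h\<^sup>2 * (card X - 1) \<le> 8 * h * \<Psi> U"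
    also have "\<Psi> U \<le> (\<Sum>v\<in>X. h)"
      unfolding \<Psi>_def by (intro sum_mono) simp
    then have "8 * h * \<Psi> U \<le> 8 * h * (card X * h)"
      by (intro mult_le_mono2) simp
    finally have "h\<^sup>2 * (17 * (card X - 1)) \<le> h\<^sup>2 * (8 * card X)"
      by (simp add: power2_eq_square algebra_simps)
    then have "17 * (card X - 1) \<le> 8 * card X"
      using h(1) by simp
    then show False
      using X by linarith
  qed
  then show thesis
    using that[OF h(1,3) L U] cases by (simp add: Y_def)
qed

section \<open>Colourings of bounded dual VC-dimension\<close>

text \<open>A vertex set of which all pairs have colour \<open>q\<close>.\<close>
definition mono_clique :: "(nat set \<Rightarrow> nat) \<Rightarrow> nat \<Rightarrow> nat set \<Rightarrow> bool" where
  "mono_clique \<chi> q H \<longleftrightarrow> (\<forall>u\<in>H. \<forall>v\<in>H. u \<noteq> v \<longrightarrow> \<chi> {u, v} = q)"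

lemma mono_clique_insert:
  assumes "mono_clique \<chi> q H" "\<And>v. v \<in> H \<Longrightarrow> \<chi> {u, v} = q"
  shows "mono_clique \<chi> q (insert u H)"
  using assms by (auto simp: mono_clique_def insert_commute)

lemma shattered_dual_system_card_le:
  assumes "coloring_dual_vc_dim n m \<chi> \<le> enat d"
    and "S \<subseteq> nbhd_system n m \<chi>" "finite S" "shatters (dual_system {..<n} (nbhd_system n m \<chi>)) S"
  shows "card S \<le> d"
proof -
  have "enat (card S) \<le> coloring_dual_vc_dim n m \<chi>"
    unfolding coloring_dual_vc_dim_def dual_vc_dim_def vc_dim_def
    using assms(2-4) by (intro SUP_upper) auto
  then show ?thesis
    using assms(1) order_trans by fastforce
qed

lemma card_dual_traces_le:
  assumes vc: "coloring_dual_vc_dim n m \<chi> \<le> enat d"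
    and G: "G \<subseteq> nbhd_system n m \<chi>" "finite G" and X: "X \<subseteq> {..<n}"
  shows "card ((\<lambda>v. {A \<in> G. v \<in> A}) ` X) \<le> (card G + 1) ^ d"
proof (rule sauer_shelah)
  fix S assume S: "S \<subseteq> G" and sh: "shatters ((\<lambda>v. {A \<in> G. v \<in> A}) ` X) S"
  have "shatters (dual_system {..<n} (nbhd_system n m \<chi>)) S"
    unfolding shatters_def
  proof (intro allI impI)
    fix B assume "B \<subseteq> S"
    then obtain v where v: "v \<in> X" "{A \<in> G. v \<in> A} \<inter> S = B"
      using sh unfolding shatters_def by blast
    show "\<exists>A\<in>dual_system {..<n} (nbhd_system n m \<chi>). A \<inter> S = B"
      by (rule bexI[of _ "{A \<in> nbhd_system n m \<chi>. v \<in> A}"])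
        (use v S G X in \<open>auto simp: dual_system_def\<close>)
  qed
  then show "card S \<le> d"
    using shattered_dual_system_card_le[OF vc] S G finite_subset by blast
qed (use G in auto)

lemma ex_large_fibre:
  assumes "finite Y" "Y \<noteq> {}" "card (g ` Y) \<le> p"
  obtains y where "y \<in> Y" "card Y \<le> p * card {z \<in> Y. g z = g y}"
proof -
  have "\<exists>t\<in>g ` Y. card Y \<le> p * card {z \<in> Y. g z = t}"
  proof (rule ccontr)
    assume "\<not> ?thesis"
    then have less: "p * card {z \<in> Y. g z = t} < card Y" if "t \<in> g ` Y" for t
      using that by auto
    have "p * card Y = (\<Sum>t\<in>g ` Y. p * card {z \<in> Y. g z = t})"
      using sum.image_gen[OF assms(1), of "\<lambda>_. 1::nat" g]
      by (simp add: sum_distrib_left[symmetric])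
    also have "\<dots> < (\<Sum>t\<in>g ` Y. card Y)"
      using assms less by (intro sum_strict_mono) auto
    also have "\<dots> \<le> p * card Y"
      using assms by simp
    finally show False by simp
  qed
  then show thesis
    using that by auto
qed

text \<open>The factor by which the number of vertices may drop for each colour whose clique number drops.\<close>
definition growth :: "nat \<Rightarrow> nat" where
  "growth d = 16 * 272 ^ d"

lemma growth_pos: "growth d \<ge> 1"
  using one_le_power[of "272::nat" d] by (simp add: growth_def)

lemma growth_bound:
  assumes "h \<ge> 1" "l + 1 < 2 ^ (h + 1)"
  shows "8 * h * (17 * h\<^sup>2 * l + 1) ^ d \<le> growth d ^ h"
proof -
  have h2: "h \<le> 2 ^ h"
    by (simp add: less_imp_le)
  have h2sq: "h\<^sup>2 \<le> (2 ^ h)\<^sup>2"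
    using h2 by (rule power_mono) simp
  have c: "(c::nat) \<le> c ^ h" if "c \<ge> 1" for c
    using that assms(1) by (simp add: self_le_power)
  have "17 * h\<^sup>2 * l + 1 \<le> 17 * h\<^sup>2 * (l + 1)"
    using assms(1) by (simp add: Suc_le_eq)
  also have "\<dots> \<le> 17 * (2 ^ h)\<^sup>2 * 2 ^ (h + 1)"
    using h2sq assms(2) by (intro mult_le_mono) auto
  also have "\<dots> = 34 * ((2 ^ h) * (2 ^ h) * 2 ^ h)"
    by (simp add: power2_eq_square)
  also have "\<dots> \<le> 34 ^ h * ((2 ^ h) * (2 ^ h) * 2 ^ h)"
    using c[of 34] by (intro mult_le_mono1) simp
  also have "\<dots> = 272 ^ h"
    by (simp flip: power_mult_distrib)
  finally have "(17 * h\<^sup>2 * l + 1) ^ d \<le> (272 ^ h) ^ d"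
    by (rule power_mono) simp
  moreover have "8 * h \<le> 16 ^ h"
  proof -
    have "8 * h \<le> 8 ^ h * 2 ^ h"
      using c[of 8] h2 by (intro mult_le_mono) auto
    then show ?thesis
      by (simp flip: power_mult_distrib)
  qed
  ultimately have "8 * h * (17 * h\<^sup>2 * l + 1) ^ d \<le> 16 ^ h * (272 ^ h) ^ d"
    by (rule mult_le_mono[rotated])
  also have "\<dots> = growth d ^ h"
    by (simp add: growth_def power_mult_distrib mult.commute flip: power_mult)
  finally show ?thesis .
qed

text \<open>
  The colours in \<open>Q\<close> are those that the vertices of the most popular trace see; the vertex \<open>u\<close>
  through which such a colour \<open>q\<close> is seen is joined in colour \<open>q\<close> to all of \<open>W\<close>.
\<close>
lemma ex_large_subset_dominated_in_many_colours:
  assumes col: "\<chi> \<in> edge_colorings n m" and vc: "coloring_dual_vc_dim n m \<chi> \<le> enat d"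
    and X: "X \<subseteq> {..<n}" "card X \<ge> 2"
  obtains h W Q where "h \<ge> 1" "W \<subseteq> X" "W \<noteq> {}" "card X \<le> growth d ^ h * card W"
    "Q \<subseteq> {..<m}" "card Q \<ge> h"
    "\<And>q. q \<in> Q \<Longrightarrow> \<exists>u\<in>X - W. \<forall>v\<in>W. \<chi> {u, v} = q"
proof -
  define f where "f = (\<lambda>u v. \<chi> {u, v})"
  have finX: "finite X"
    using X finite_subset by blast
  have sym: "f u v = f v u" for u v
    by (simp add: f_def insert_commute)
  have f: "f u v \<in> {..<m}" if "u \<in> X" "v \<in> X" "u \<noteq> v" for u v
  proof -
    have "{u, v} \<in> [{..<n}]\<^bsup>2\<^esup>"
      using that X by (auto simp: nsets_def)
    then show ?thesis
      using col by (auto simp: edge_colorings_def f_def)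
  qed
  obtain h l :: nat and L U where h: "h \<ge> 1" "l + 1 < 2 ^ (h + 1)"
    and L: "\<And>u. u \<in> X \<Longrightarrow> L u \<subseteq> {..<m} \<and> card (L u) \<le> l"
    and U: "U \<subseteq> X" "card U \<le> 17 * h\<^sup>2"
    and many: "card X \<le> 8 * h * card {v \<in> X. card (seen_colours f L U v) \<ge> h}"
    by (rule ex_lists_seeing_many_colours[of X "{..<m}" f]) (use finX X sym f in auto)
  define Y where "Y = {v \<in> X. card (seen_colours f L U v) \<ge> h}"
  define G where "G = (\<lambda>(u, q). color_nbhd n \<chi> q u) ` (SIGMA u:U. L u)"
  have finU: "finite U"
    using U finX finite_subset by blast
  have finL: "finite (L u)" if "u \<in> X" for u
    using L[OF that] finite_subset by blast
  have finS: "finite (SIGMA u:U. L u)"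
    using finU finL U by auto
  have "card G \<le> card (SIGMA u:U. L u)"
    unfolding G_def by (rule card_image_le[OF finS])
  also have "\<dots> = (\<Sum>u\<in>U. card (L u))"
    using finU finL U by (intro card_SigmaI) auto
  also have "\<dots> \<le> card U * l"
    using sum_bounded_above[of U "\<lambda>u. card (L u)" l] L U by auto
  also have "\<dots> \<le> 17 * h\<^sup>2 * l"
    using U by (intro mult_le_mono1)
  finally have cardG: "card G \<le> 17 * h\<^sup>2 * l" .
  have G: "G \<subseteq> nbhd_system n m \<chi>"
    using L U X by (fastforce simp: G_def nbhd_system_def)
  have finY: "finite Y" and YX: "Y \<subseteq> X"
    using finX by (auto simp: Y_def)
  have "card X \<le> 8 * h * card Y"
    using many by (simp add: Y_def)
  then have "Y \<noteq> {}"
    using X by auto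
  have "card ((\<lambda>v. {A \<in> G. v \<in> A}) ` Y) \<le> (card G + 1) ^ d"
    by (rule card_dual_traces_le[OF vc G]) (use finS YX X in \<open>auto simp: G_def\<close>)
  also have "\<dots> \<le> (17 * h\<^sup>2 * l + 1) ^ d"
    using cardG by (intro power_mono) auto
  finally obtain y where y: "y \<in> Y" and fibre: "card Y \<le> (17 * h\<^sup>2 * l + 1) ^ d
      * card {z \<in> Y. {A \<in> G. z \<in> A} = {A \<in> G. y \<in> A}}"
    by (rule ex_large_fibre[OF finY \<open>Y \<noteq> {}\<close>])
  define W where "W = {z \<in> Y. {A \<in> G. z \<in> A} = {A \<in> G. y \<in> A}}"
  show thesis
  proof (rule that[OF h(1), of W "seen_colours f L U y"])
    show "W \<subseteq> X" "W \<noteq> {}"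
      using YX y by (auto simp: W_def)
    have "card X \<le> 8 * h * card Y"
      by fact
    also have "\<dots> \<le> 8 * h * ((17 * h\<^sup>2 * l + 1) ^ d * card W)"
      unfolding W_def by (rule mult_le_mono2[OF fibre])
    also have "\<dots> = (8 * h * (17 * h\<^sup>2 * l + 1) ^ d) * card W"
      by (simp add: mult.assoc)
    also have "\<dots> \<le> growth d ^ h * card W"
      by (rule mult_le_mono1[OF growth_bound[OF h]])
    finally show "card X \<le> growth d ^ h * card W" .
    show "seen_colours f L U y \<subseteq> {..<m}"
      using L U by (auto simp: seen_colours_def)
    show "h \<le> card (seen_colours f L U y)"
      using y by (simp add: Y_def)
    fix q assume "q \<in> seen_colours f L U y"
    then obtain u where u: "u \<in> U" "u \<noteq> y" "f u y = q" "q \<in> L u"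
      by (auto simp: seen_colours_def)
    define A where "A = color_nbhd n \<chi> q u"
    have "A \<in> G"
      using u by (auto simp: G_def A_def)
    moreover have "y \<in> A"
      using u y YX X by (auto simp: A_def color_nbhd_def f_def insert_commute)
    ultimately have WA: "W \<subseteq> A"
      unfolding W_def by blast
    then have "u \<notin> W"
      by (auto simp: A_def color_nbhd_def)
    moreover have "\<forall>v\<in>W. \<chi> {u, v} = q"
      using WA by (auto simp: A_def color_nbhd_def insert_commute)
    ultimately show "\<exists>u\<in>X - W. \<forall>v\<in>W. \<chi> {u, v} = q"
      using u(1) U(1) by blast
  qed
qed

text \<open>Here \<open>w q + 1\<close> is an upper bound for the clique number of colour \<open>q\<close>, so that the bound is
  tight for a single vertex, where \<open>w = 0\<close> is possible.\<close>
lemma card_le_growth_power: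
  assumes col: "\<chi> \<in> edge_colorings n m" and vc: "coloring_dual_vc_dim n m \<chi> \<le> enat d"
    and "X \<subseteq> {..<n}"
    and "\<And>q H. q < m \<Longrightarrow> H \<subseteq> X \<Longrightarrow> mono_clique \<chi> q H \<Longrightarrow> card H \<le> w q + 1"
  shows "card X \<le> growth d ^ (\<Sum>q<m. w q)"
  using assms(3,4)
proof (induction "\<Sum>q<m. w q" arbitrary: X w rule: less_induct)
  case less
  have g: "growth d \<ge> 1"
    by (rule growth_pos)
  show ?case
  proof (cases "card X \<ge> 2")
    case False
    then show ?thesis
      using one_le_power[OF g, of "\<Sum>q<m. w q"] by linarith
  next
    case True
    obtain h W Q where h: "h \<ge> 1" and W: "W \<subseteq> X" "W \<noteq> {}"
      and large: "card X \<le> growth d ^ h * card W"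
      and Q: "Q \<subseteq> {..<m}" "card Q \<ge> h"
      and dom: "\<And>q. q \<in> Q \<Longrightarrow> \<exists>u\<in>X - W. \<forall>v\<in>W. \<chi> {u, v} = q"
      using ex_large_subset_dominated_in_many_colours[OF col vc less.prems(1) True] by metis
    define w' where "w' = (\<lambda>q. if q \<in> Q then w q - 1 else w q)"
    have finX: "finite X"
      using less.prems(1) finite_subset by blast
    have ext: "card H + 1 \<le> w q + 1" if q: "q \<in> Q" and "H \<subseteq> W" "mono_clique \<chi> q H" for q H
    proof -
      obtain u where u: "u \<in> X - W" "\<forall>v\<in>W. \<chi> {u, v} = q"
        using dom[OF q] by blast
      have "mono_clique \<chi> q (insert u H)"
        using that u by (intro mono_clique_insert) auto
      then have "card (insert u H) \<le> w q + 1"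
        using less.prems(2)[of q "insert u H"] q that u W Q by auto
      moreover have "card (insert u H) = card H + 1"
        using that u W finX finite_subset[of H X] by (subst card_insert_disjoint) auto
      ultimately show ?thesis
        by simp
    qed
    have w_pos: "w q \<ge> 1" if "q \<in> Q" for q
    proof -
      obtain v where "v \<in> W"
        using W by blast
      then show ?thesis
        using ext[OF that, of "{v}"] by (auto simp: mono_clique_def)
    qed
    have w_eq: "w q = w' q + (if q \<in> Q then 1 else 0)" for q
      using w_pos[of q] by (auto simp: w'_def)
    have sum_eq: "(\<Sum>q<m. w q) = (\<Sum>q<m. w' q) + card Q"
      unfolding w_eq sum.distrib using Q(1) by (simp add: sum.If_cases Int_absorb1)
    have "card W \<le> growth d ^ (\<Sum>q<m. w' q)"
    proof (rule less.hyps)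
      show "(\<Sum>q<m. w' q) < (\<Sum>q<m. w q)"
        using sum_eq Q(2) h by simp
      show "W \<subseteq> {..<n}"
        using W less.prems(1) by blast
      fix q H assume "q < m" "H \<subseteq> W" "mono_clique \<chi> q H"
      then show "card H \<le> w' q + 1"
        using ext[of q H] less.prems(2)[of q H] W(1) w_eq[of q] by (auto split: if_splits)
    qed
    moreover have "growth d ^ h \<le> growth d ^ card Q"
      using Q(2) g by (rule power_increasing)
    ultimately have "growth d ^ h * card W \<le> growth d ^ card Q * growth d ^ (\<Sum>q<m. w' q)"
      by (intro mult_le_mono)
    then show ?thesis
      using large by (simp add: sum_eq power_add mult.commute)
  qed
qed

lemma forces_mono_clique_growth:
  assumes "k \<ge> 1"
  shows "forces_mono_clique d k m (growth d ^ (k * m) + 1)"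
  unfolding forces_mono_clique_def
proof (intro ballI impI)
  define n where "n = growth d ^ (k * m) + 1"
  fix \<chi> assume "\<chi> \<in> edge_colorings (growth d ^ (k * m) + 1) m"
    and "coloring_dual_vc_dim (growth d ^ (k * m) + 1) m \<chi> \<le> enat d"
  then have \<chi>: "\<chi> \<in> edge_colorings n m" "coloring_dual_vc_dim n m \<chi> \<le> enat d"
    by (simp_all add: n_def)
  have "\<exists>q<m. monochromatic {..<n} k 2 \<chi> q"
  proof (rule ccontr)
    assume no: "\<not> ?thesis"
    have "card H \<le> k + 1" if H: "q < m" "H \<subseteq> {..<n}" "mono_clique \<chi> q H" for q H
    proof (rule ccontr)
      assume "\<not> ?thesis"
      then obtain T where T: "T \<subseteq> H" "card T = k" "finite T"
        by (meson obtain_subset_with_card_n nat_le_linear not_less_eq_eq le_add1 le_trans)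
      have "\<chi> ` [T]\<^bsup>2\<^esup> \<subseteq> {q}"
        using T(1) H(3) by (auto simp: mono_clique_def nsets_def card_2_iff)
      moreover have "T \<in> [{..<n}]\<^bsup>k\<^esup>"
        using T H(2) by (auto simp: nsets_def)
      ultimately have "monochromatic {..<n} k 2 \<chi> q"
        unfolding monochromatic_def by blast
      then show False
        using no H(1) by blast
    qed
    then have "card {..<n} \<le> growth d ^ (\<Sum>q<m. k)"
      by (intro card_le_growth_power[OF \<chi>]) auto
    then show False
      by (simp add: n_def mult.commute)
  qed
  then show "\<exists>q<m. monochromatic {..<growth d ^ (k * m) + 1} k 2 \<chi> q"
    by (simp add: n_def)
qed

theorem theorem1p3:
  fixes k d :: nat
  assumes "k \<ge> 3" and "d \<ge> 2"
  shows "\<exists>c::real. \<forall>m::nat. m \<ge> 2 \<longrightarrow> real (ramsey_vc d k m) \<le> 2 powr (c * real m)"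
proof (intro exI allI impI)
  fix m :: nat assume m: "m \<ge> 2"
  define g where "g = real (growth d)"
  have g: "g \<ge> 1"
    using growth_pos[of d] by (simp add: g_def)
  have "ramsey_vc d k m \<le> growth d ^ (k * m) + 1"
    unfolding ramsey_vc_def using assms by (intro Least_le forces_mono_clique_growth) simp
  then have "real (ramsey_vc d k m) \<le> real (growth d ^ (k * m) + 1)"
    by (simp only: of_nat_le_iff)
  also have "\<dots> = g ^ (k * m) + 1"
    by (simp add: g_def)
  also have "\<dots> \<le> 2 * g ^ (k * m)"
    using one_le_power[OF g, of "k * m"] by simp
  also have "\<dots> \<le> 2 powr real m * g ^ (k * m)"
    using m g powr_mono[of 1 "real m" 2] by (intro mult_right_mono) auto
  also have "g ^ (k * m) = 2 powr (log 2 g * real (k * m))"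
    using g by (simp add: powr_realpow flip: powr_powr del: of_nat_mult)
  also have "2 powr real m * \<dots> = 2 powr ((1 + real k * log 2 g) * real m)"
    by (simp add: algebra_simps flip: powr_add)
  finally show "real (ramsey_vc d k m) \<le> 2 powr ((1 + real k * log 2 (real (growth d))) * real m)"
    by (simp add: g_def)
qed

end
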